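(* Consider the equation $$\dot{x}(t)-a(t)\dot{x}(g(t))=-\sum_{k=1}^m b_k(t)x(h_k(t)),\quad t\geq t_0,$$ under the standing assumptions listed in the context. Assume that for some $\alpha>0$, $b(t):=\sum_{k=1}^m b_k(t)\geq\alpha$ for $t\geq t_0$, that $\|a\|_{[t_0,\infty)}<1$, and that $$\left(\frac{\sum_{k=1}^m\|b_k\|_{[t_0,\infty)}}{1-\|a\|_{[t_0,\infty)}}\right)\left(\left\|\frac{a}{b}\right\|_{[t_0,\infty)}+\sum_{k=1}^m\tau_k\left\|\frac{b_k}{b}\right\|_{[t_0,\infty)}\right)<1.$$ Then the equation is uniformly exponentially stable.
   Context: Standing assumptions: $t_0\geq 0$ and $m\geq 1$. The real-valued functions $a,b_k,g,h_k$ ($k=1,\dots,m$) are Lebesgue measurable on $[t_0,\infty)$ (not necessarily continuous); $|a(t)|\leq A_0<1$ for $t\geq t_0$; $b_0\leq b_k(t)\leq B_k$ for $t\geq t_0$ with real constants $b_0,B_k$ (no sign assumption on $b_k$). There are constants $\sigma>0$, $\tau_k>0$ such that $0\leq t-g(t)\leq\sigma$ and $0\leq t-h_k(t)\leq\tau_k$ for $t\geq t_0$, $k=1,\dots,m$. For every set $E$ of Lebesgue measure zero, $g^{-1}(E)$ has Lebesgue measure zero. Norm: $\|y\|_{[t_0,\infty)}=\operatorname{ess\,sup}_{t\geq t_0}|y(t)|$. Solutions: for an initial point $s\geq t_0$ and Borel measurable bounded functions $\varphi:(-\infty,s]\to\mathbb{R}$, $\psi:(-\infty,s)\to\mathbb{R}$,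 the solution with this initial data is the function $x:\mathbb{R}\to\mathbb{R}$, locally absolutely continuous on $[s,\infty)$, which satisfies the equation for almost all $t\geq s$, with $x(t)=\varphi(t)$ for $t\leq s$ and $\dot{x}(t)=\psi(t)$ for $t<s$ (where $g(t)<s$, $\dot{x}(g(t))$ means $\psi(g(t))$; where $h_k(t)\leq s$, $x(h_k(t))$ means $\varphi(h_k(t))$; $\varphi$ and $\psi$ are independent data). Uniform exponential stability: there exist $M>0$ and $\gamma>0$, independent of the initial point $s\geq t_0$ and of $\varphi,\psi$, such that every such solution satisfies $$|x(t)|\leq Me^{-\gamma(t-s)}\sup_{\xi\in(-\infty,s]}(|\varphi(\xi)|+|\psi(\xi)|),\quad t\geq s$$ (with $\psi$ contributing only for $\xi<s$).
   Formalization: Solutions are additionally required to have a derivative that is essentially bounded on each [s,T]; with local absolute continuity alone, zero initial data can admit a nonzero solution when g has fixed points, so the stated estimate would fail. *)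

theory Defs
  imports "HOL-Analysis.Analysis" "HOL-Probability.Essential_Supremum"
begin

(* The essential supremum is taken in ereal. It is finite for the functions used here, which are
   measurable and essentially bounded; on any other function real_of_ereal would return 0. *)
definition ess_norm :: "real \<Rightarrow> (real \<Rightarrow> real) \<Rightarrow> real" where
  "ess_norm t0 y = real_of_ereal (esssup (lebesgue_on {t0..}) (\<lambda>t. ereal \<bar>y t\<bar>))"

(* The usual epsilon-delta definition. A division consists of finitely many non-overlapping compact
   intervals, and K = {Inf K..Sup K} for each of them. *)
definition abs_cont_on :: "(real \<Rightarrow> real) \<Rightarrow> real \<Rightarrow> real \<Rightarrow> bool" where
  "abs_cont_on x u v \<longleftrightarrow>
     (\<forall>\<epsilon>>0. \<exists>\<delta>>0. \<forall>D S. D division_of S \<and> S \<subseteq> {u..v} \<and> (\<Sum>K\<in>D. Sup K - Inf K) < \<delta> \<longrightarrow>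
        (\<Sum>K\<in>D. \<bar>x (Sup K) - x (Inf K)\<bar>) < \<epsilon>)"

definition locally_abs_cont_from :: "real \<Rightarrow> (real \<Rightarrow> real) \<Rightarrow> bool" where
  "locally_abs_cont_from s x \<longleftrightarrow> (\<forall>T\<ge>s. abs_cont_on x s T)"

definition locally_ess_bounded_deriv_from :: "real \<Rightarrow> (real \<Rightarrow> real) \<Rightarrow> bool" where
  "locally_ess_bounded_deriv_from s x \<longleftrightarrow>
     (\<forall>T\<ge>s. \<exists>C. AE t in lebesgue_on {s..T}. \<bar>deriv x t\<bar> \<le> C)"

(* The values of \<phi> to the right of s, and of \<psi> at and to the right of s, are irrelevant. *)
definition initial_data :: "real \<Rightarrow> (real \<Rightarrow> real) \<Rightarrow> (real \<Rightarrow> real) \<Rightarrow> bool" where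
  "initial_data s \<phi> \<psi> \<longleftrightarrow>
     \<phi> \<in> borel_measurable (restrict_space borel {..s}) \<and> bounded (\<phi> ` {..s}) \<and>
     \<psi> \<in> borel_measurable (restrict_space borel {..<s}) \<and> bounded (\<psi> ` {..<s})"

(* The derivative with its prehistory: \<psi> is independent of \<phi>, hence not deriv x to the left of s. *)
definition deriv_with_history :: "real \<Rightarrow> (real \<Rightarrow> real) \<Rightarrow> (real \<Rightarrow> real) \<Rightarrow> real \<Rightarrow> real" where
  "deriv_with_history s \<psi> x t = (if t < s then \<psi> t else deriv x t)"

definition neutral_solution ::
  "nat \<Rightarrow> (real \<Rightarrow> real) \<Rightarrow> (real \<Rightarrow> real) \<Rightarrow> (nat \<Rightarrow> real \<Rightarrow> real) \<Rightarrow> (nat \<Rightarrow> real \<Rightarrow> real) \<Rightarrow>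
   real \<Rightarrow> (real \<Rightarrow> real) \<Rightarrow> (real \<Rightarrow> real) \<Rightarrow> (real \<Rightarrow> real) \<Rightarrow> bool" where
  "neutral_solution m a g b h s \<phi> \<psi> x \<longleftrightarrow>
     locally_abs_cont_from s x \<and> (\<forall>t\<le>s. x t = \<phi> t) \<and>
     (AE t in lebesgue_on {s..}. x differentiable (at t) \<and>
        deriv x t - a t * deriv_with_history s \<psi> x (g t) = - (\<Sum>k=1..m. b k t * x (h k t)))"

definition initial_sup :: "real \<Rightarrow> (real \<Rightarrow> real) \<Rightarrow> (real \<Rightarrow> real) \<Rightarrow> real" where
  "initial_sup s \<phi> \<psi> = (SUP \<xi>\<in>{..s}. \<bar>\<phi> \<xi>\<bar> + (if \<xi> < s then \<bar>\<psi> \<xi>\<bar> else 0))"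

(* Solutions are taken with locally essentially bounded derivative, since g may have fixed points
   and then absolute continuity does not make the solution of the initial value problem unique.
   Example with m = 1 and t0 = s = 0: on {0..1/2} let a = 1/10, b 1 = 1, g t = t/100, h 1 t = 0;
   on {1/2<..} let a = 0, b 1 = 1, g t = t, h 1 t = t. With \<phi> = 0 and \<psi> = 0 the function equal
   to sqrt t on {0..1/2} and to sqrt (1/2) * exp (1/2 - t) beyond is a solution, besides 0.
   If t - g t is bounded away from 0 the restriction is automatic. *)
definition uniformly_exponentially_stable ::
  "real \<Rightarrow> nat \<Rightarrow> (real \<Rightarrow> real) \<Rightarrow> (real \<Rightarrow> real) \<Rightarrow> (nat \<Rightarrow> real \<Rightarrow> real) \<Rightarrow>
   (nat \<Rightarrow> real \<Rightarrow> real) \<Rightarrow> bool" where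
  "uniformly_exponentially_stable t0 m a g b h \<longleftrightarrow>
     (\<exists>M>0. \<exists>\<gamma>>0. \<forall>s\<ge>t0. \<forall>\<phi> \<psi> x.
        initial_data s \<phi> \<psi> \<longrightarrow> neutral_solution m a g b h s \<phi> \<psi> x \<longrightarrow>
        locally_ess_bounded_deriv_from s x \<longrightarrow>
        (\<forall>t\<ge>s. \<bar>x t\<bar> \<le> M * exp (- \<gamma> * (t - s)) * initial_sup s \<phi> \<psi>))"

end

theory Submission
  imports Defs
begin

text \<open>
  The idea is to estimate a solution together with its derivative, both weighted by
  \<open>e t = exp (- \<gamma> * (t - s))\<close> with a small rate \<open>\<gamma>\<close>. Put \<open>B t = \<Sum>k. b k t\<close> and fix a horizon \<open>T\<close>.
  Two forms of the equation are played against each other.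

  As it stands, the equation bounds \<open>x'\<close> by past values of \<open>x'\<close> and of \<open>x\<close>. If \<open>\<bar>x\<bar> \<le> X * e\<close> on the interval
  from \<open>s\<close> to \<open>T\<close>, then every essential bound \<open>Y * e\<close> of \<open>x'\<close> improves to \<open>(c * Y + d) * e\<close> with \<open>c\<close> close
  to \<open>\<parallel>a\<parallel> < 1\<close>, and iteration gives \<open>Y = d / (1 - c)\<close>, essentially \<open>X * (\<Sum>k. \<parallel>b k\<parallel>) / (1 - \<parallel>a\<parallel>)\<close>
  (lemma \<open>AE_deriv_le\<close>). The iteration needs some essential bound to start from, which exists as the
  derivative is locally essentially bounded.

  Rewritten as \<open>x' + B * x = B * f\<close> with
  \<open>f t = (a t / B t) * x' (g t) + (\<Sum>k. (b k t / B t) * (x t - x (h k t)))\<close>, the equation is a perturbed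
  scalar ordinary differential equation. As \<open>\<bar>x t - x (h k t)\<bar>\<close> is at most \<open>\<tau> k\<close> times a bound of the
  derivative, \<open>\<bar>f\<bar> \<le> P * e\<close> with \<open>P\<close> essentially \<open>Y * (\<parallel>a/B\<parallel> + (\<Sum>k. \<tau> k * \<parallel>b k/B\<parallel>))\<close>; and since
  \<open>B \<ge> \<alpha> > \<gamma>\<close>, the damping keeps \<open>\<bar>x\<bar>\<close> below \<open>(I + \<alpha> / (\<alpha> - \<gamma>) * P) * e\<close>, where \<open>I\<close> is the size of the
  initial data (lemma \<open>state_le\<close>).

  Together, the best \<open>X\<close> satisfies \<open>X \<le> q * X + c' * I\<close>, where \<open>q\<close> tends to the left-hand side of the
  smallness hypothesis as \<open>\<gamma>\<close> tends to 0. So \<open>q < 1\<close> for small \<open>\<gamma>\<close>, and \<open>X \<le> c' / (1 - q) * I\<close> with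
  constants independent of \<open>s\<close>, \<open>T\<close> and the initial data (lemma \<open>exponential_bound\<close>).

  The coefficients are only measurable, so \<open>x'\<close> is known almost everywhere only. The bridge from the
  derivative to the function is lemma \<open>abs_cont_on_nonincreasing\<close>: an absolutely continuous function
  whose derivative is almost everywhere at most 0 does not increase. It yields the mean value
  inequality for \<open>x t - x (h k t)\<close>, and a barrier argument which replaces the variation of
  constants formula.
\<close>

section \<open>Absolutely continuous functions\<close>

lemma abs_cont_on_iff:
  "abs_cont_on x u v \<longleftrightarrow> (\<forall>e>0. \<exists>d>0. \<forall>D S. D division_of S \<longrightarrow> S \<subseteq> {u..v} \<longrightarrow>
     (\<Sum>K\<in>D. Sup K - Inf K) < d \<longrightarrow> (\<Sum>K\<in>D. \<bar>x (Sup K) - x (Inf K)\<bar>) < e)"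
  unfolding abs_cont_on_def imp_conjL by (rule refl)

lemmas abs_cont_onI = abs_cont_on_iff[THEN iffD2, OF allI, OF impI]
lemmas abs_cont_onD = abs_cont_on_iff[THEN iffD1, THEN spec, THEN mp]

lemma division_interval_cases:
  fixes D :: "real set set"
  assumes "D division_of S" "K \<in> D"
  obtains p q where "K = {p..q}" "p \<le> q" "{p..q} \<subseteq> S"
proof -
  obtain p q where "K = {p..q}"
    using division_ofD(4)[OF assms] by (auto simp: cbox_interval)
  moreover have "K \<noteq> {}" "K \<subseteq> S"
    using division_ofD(2,3)[OF assms(1)] assms(2) by blast+
  ultimately show thesis
    using that by auto
qed

lemma abs_cont_on_subinterval:
  assumes "abs_cont_on x u v" "u \<le> u'" "v' \<le> v"
  shows "abs_cont_on x u' v'"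
proof (rule abs_cont_onI)
  fix e :: real
  assume "e > 0"
  then obtain d where "d > 0" and d: "\<forall>D S. D division_of S \<longrightarrow> S \<subseteq> {u..v} \<longrightarrow>
      (\<Sum>K\<in>D. Sup K - Inf K) < d \<longrightarrow> (\<Sum>K\<in>D. \<bar>x (Sup K) - x (Inf K)\<bar>) < e"
    using abs_cont_onD[OF assms(1)] by blast
  note d = d[rule_format]
  have "{u'..v'} \<subseteq> {u..v}"
    using assms by auto
  then show "\<exists>d>0. \<forall>D S. D division_of S \<longrightarrow> S \<subseteq> {u'..v'} \<longrightarrow>
      (\<Sum>K\<in>D. Sup K - Inf K) < d \<longrightarrow> (\<Sum>K\<in>D. \<bar>x (Sup K) - x (Inf K)\<bar>) < e"
    using \<open>d > 0\<close> by (intro exI[of _ d] conjI allI impI) (auto intro!: d)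
qed

lemma abs_cont_on_imp_continuous_on:
  assumes "abs_cont_on x u v"
  shows "continuous_on {u..v} x"
  unfolding continuous_on_iff
proof (intro ballI allI impI)
  fix t and e :: real
  assume t: "t \<in> {u..v}" and "e > 0"
  then obtain d where "d > 0" and d: "\<forall>D S. D division_of S \<longrightarrow> S \<subseteq> {u..v} \<longrightarrow>
      (\<Sum>K\<in>D. Sup K - Inf K) < d \<longrightarrow> (\<Sum>K\<in>D. \<bar>x (Sup K) - x (Inf K)\<bar>) < e"
    using abs_cont_onD[OF assms] by blast
  note d = d[rule_format]
  have small: "\<bar>x q - x p\<bar> < e" if "u \<le> p" "p \<le> q" "q \<le> v" "q - p < d" for p q
    using d[of "{{p..q}}" "{p..q}"] that division_of_self[of p q] by simp
  have "dist (x t') (x t) < e" if "t' \<in> {u..v}" "dist t' t < d" for t'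
    using small[of t t'] small[of t' t] that t by (cases "t \<le> t'") (auto simp: dist_real_def)
  then show "\<exists>d>0. \<forall>t'\<in>{u..v}. dist t' t < d \<longrightarrow> dist (x t') (x t) < e"
    using \<open>d > 0\<close> by blast
qed

lemma lipschitz_imp_abs_cont_on:
  assumes "\<And>p q. u \<le> p \<Longrightarrow> p \<le> q \<Longrightarrow> q \<le> v \<Longrightarrow> \<bar>f q - f p\<bar> \<le> L * (q - p)"
  shows "abs_cont_on f u v"
proof (rule abs_cont_onI)
  fix e :: real
  assume "e > 0"
  define L' where "L' = \<bar>L\<bar> + 1"
  have "(\<Sum>K\<in>D. \<bar>f (Sup K) - f (Inf K)\<bar>) < e"
    if D: "D division_of S" "S \<subseteq> {u..v}" "(\<Sum>K\<in>D. Sup K - Inf K) < e / L'" for D S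
  proof -
    have "(\<Sum>K\<in>D. \<bar>f (Sup K) - f (Inf K)\<bar>) \<le> (\<Sum>K\<in>D. L' * (Sup K - Inf K))"
    proof (rule sum_mono)
      fix K
      assume K: "K \<in> D"
      then obtain p q where pq: "K = {p..q}" "p \<le> q" "{p..q} \<subseteq> {u..v}"
        using D(1,2) by (metis division_interval_cases order_trans)
      then have "\<bar>f q - f p\<bar> \<le> L * (q - p)"
        by (intro assms) auto
      also have "\<dots> \<le> L' * (q - p)"
        using pq(2) by (intro mult_right_mono) (auto simp: L'_def)
      finally show "\<bar>f (Sup K) - f (Inf K)\<bar> \<le> L' * (Sup K - Inf K)"
        using pq by simp
    qed
    also have "\<dots> = (\<Sum>K\<in>D. Sup K - Inf K) * L'"
      by (simp add: sum_distrib_left mult.commute)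
    also have "\<dots> < e"
      using D(3) by (simp add: pos_less_divide_eq L'_def)
    finally show ?thesis .
  qed
  moreover have "e / L' > 0"
    using \<open>e > 0\<close> by (simp add: L'_def)
  ultimately show "\<exists>\<delta>>0. \<forall>D S. D division_of S \<longrightarrow> S \<subseteq> {u..v} \<longrightarrow> (\<Sum>K\<in>D. Sup K - Inf K) < \<delta> \<longrightarrow>
      (\<Sum>K\<in>D. \<bar>f (Sup K) - f (Inf K)\<bar>) < e"
    by blast
qed

lemma abs_cont_on_diff:
  assumes "abs_cont_on x u v" "abs_cont_on y u v"
  shows "abs_cont_on (\<lambda>t. x t - y t) u v"
proof (rule abs_cont_onI)
  fix e :: real
  assume "e > 0"
  then have "e / 2 > 0"
    by simp
  then obtain d1 where "d1 > 0" and d1: "\<forall>D S. D division_of S \<longrightarrow> S \<subseteq> {u..v} \<longrightarrow>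
      (\<Sum>K\<in>D. Sup K - Inf K) < d1 \<longrightarrow> (\<Sum>K\<in>D. \<bar>x (Sup K) - x (Inf K)\<bar>) < e / 2"
    using abs_cont_onD[OF assms(1)] by blast
  note d1 = d1[rule_format]
  obtain d2 where "d2 > 0" and d2: "\<forall>D S. D division_of S \<longrightarrow> S \<subseteq> {u..v} \<longrightarrow>
      (\<Sum>K\<in>D. Sup K - Inf K) < d2 \<longrightarrow> (\<Sum>K\<in>D. \<bar>y (Sup K) - y (Inf K)\<bar>) < e / 2"
    using abs_cont_onD[OF assms(2) \<open>e / 2 > 0\<close>] by blast
  note d2 = d2[rule_format]
  have "(\<Sum>K\<in>D. \<bar>(x (Sup K) - y (Sup K)) - (x (Inf K) - y (Inf K))\<bar>) < e"
    if "D division_of S" "S \<subseteq> {u..v}" "(\<Sum>K\<in>D. Sup K - Inf K) < min d1 d2" for D S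
  proof -
    have "(\<Sum>K\<in>D. \<bar>(x (Sup K) - y (Sup K)) - (x (Inf K) - y (Inf K))\<bar>)
        \<le> (\<Sum>K\<in>D. \<bar>x (Sup K) - x (Inf K)\<bar> + \<bar>y (Sup K) - y (Inf K)\<bar>)"
      by (intro sum_mono) linarith
    also have "\<dots> < e"
      using d1[OF that(1,2)] d2[OF that(1,2)] that(3) by (simp add: sum.distrib)
    finally show ?thesis .
  qed
  then show "\<exists>\<delta>>0. \<forall>D S. D division_of S \<longrightarrow> S \<subseteq> {u..v} \<longrightarrow> (\<Sum>K\<in>D. Sup K - Inf K) < \<delta> \<longrightarrow>
      (\<Sum>K\<in>D. \<bar>(x (Sup K) - y (Sup K)) - (x (Inf K) - y (Inf K))\<bar>) < e"
    using \<open>d1 > 0\<close> \<open>d2 > 0\<close> by (intro exI[of _ "min d1 d2"]) auto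
qed

text \<open>
  The total length of non-overlapping intervals is the measure of their union.
\<close>

lemma division_total_length_in_cover:
  fixes D :: "real set set"
  assumes "D division_of S" "S \<subseteq> U" "open U" "emeasure lebesgue U < ennreal d"
  shows "(\<Sum>K\<in>D. Sup K - Inf K) < d"
proof -
  have "(\<Sum>K\<in>D. Sup K - Inf K) = (\<Sum>K\<in>D. measure lebesgue K)"
  proof (rule sum.cong)
    fix K
    assume "K \<in> D"
    with assms(1) obtain p q where "K = {p..q}" "p \<le> q"
      by (rule division_interval_cases)
    then show "Sup K - Inf K = measure lebesgue K"
      by simp
  qed simp
  also have "\<dots> = measure lebesgue S"
    using content_division[OF assms(1)] by simp
  also have "\<dots> < d"
  proof -
    have "S \<in> lmeasurable"
      using assms(1) by (rule lmeasurable_division)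
    then have "ennreal (measure lebesgue S) = emeasure lebesgue S"
      by (simp add: emeasure_eq_measure2)
    also have "\<dots> \<le> emeasure lebesgue U"
      using assms(2,3) by (intro emeasure_mono) (auto simp: borel_open)
    also have "\<dots> < ennreal d"
      by (rule assms(4))
    finally show ?thesis
      by (simp add: ennreal_less_iff)
  qed
  finally show ?thesis .
qed

text \<open>
  Take an open cover of small measure of the exceptional null set, and a tagged division of the
  interval so fine that intervals with an exceptional tag lie in that cover. Their total length is
  small, so by absolute continuity they contribute little to \<open>x v - x u\<close>; on each other interval the
  derivative at the tag bounds the increment of \<open>x\<close> by \<open>e\<close> times the length.
\<close>

lemma abs_cont_on_nonincreasing:
  assumes "u \<le> v" and ac: "abs_cont_on x u v"
    and ae: "AE t in lebesgue. u < t \<and> t < v \<longrightarrow> (\<exists>d\<le>0. (x has_real_derivative d) (at t))"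
  shows "x v \<le> x u"
proof (rule field_le_epsilon)
  fix e0 :: real
  assume "e0 > 0"
  define e where "e = e0 / (v - u + 1)"
  have "e > 0"
    using \<open>e0 > 0\<close> \<open>u \<le> v\<close> by (simp add: e_def)
  obtain N where N: "N \<in> null_sets lebesgue"
    "\<And>t. t \<notin> N \<Longrightarrow> u < t \<and> t < v \<longrightarrow> (\<exists>d\<le>0. (x has_real_derivative d) (at t))"
    using ae by (auto elim: AE_E3)
  \<comment> \<open>The end points count as exceptional, since nothing is assumed about the derivative there.\<close>
  define E where "E = N \<union> {u, v}"
  have E_null: "E \<in> null_sets lebesgue"
    unfolding E_def using N(1) by (intro null_sets.Un) (simp_all add: negligible_iff_null_sets[symmetric])
  obtain \<delta> where "\<delta> > 0" and \<delta>: "\<forall>D S. D division_of S \<longrightarrow> S \<subseteq> {u..v} \<longrightarrow>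
      (\<Sum>K\<in>D. Sup K - Inf K) < \<delta> \<longrightarrow> (\<Sum>K\<in>D. \<bar>x (Sup K) - x (Inf K)\<bar>) < e"
    using abs_cont_onD[OF ac \<open>e > 0\<close>] by blast
  note \<delta> = \<delta>[rule_format]
  have "E \<in> sets lebesgue"
    using E_null by (rule null_setsD2)
  then obtain U where U: "open U" "E \<subseteq> U" "emeasure lebesgue (U - E) < ennreal \<delta>"
    using \<open>\<delta> > 0\<close> by (rule sets_lebesgue_outer_open)
  have "emeasure lebesgue (U - E) = emeasure lebesgue U"
    using E_null U(1) by (intro emeasure_Diff_null_set) (auto simp: borel_open)
  then have U3: "emeasure lebesgue U < ennreal \<delta>"
    using U(3) by simp
  have "\<exists>r>0. \<forall>y z. t - r < y \<and> y \<le> t \<and> t \<le> z \<and> z < t + r \<longrightarrow> x z - x y \<le> e * (z - y)"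
    if t: "t \<in> {u..v} - E" for t
  proof -
    obtain d where "d \<le> 0" and d: "(x has_real_derivative d) (at t)"
      using N(2)[of t] t by (auto simp: E_def)
    obtain r where "r > 0" and r: "\<And>y. norm (y - t) < r \<Longrightarrow> norm (x y - x t - d * (y - t)) \<le> e * norm (y - t)"
      using d \<open>e > 0\<close> unfolding has_field_derivative_def has_derivative_at_alt by blast
    have "x z - x y \<le> e * (z - y)" if "t - r < y" "y \<le> t" "t \<le> z" "z < t + r" for y z
    proof -
      have "x z - x t - d * (z - t) \<le> e * (z - t)" "- (x y - x t - d * (y - t)) \<le> e * (t - y)"
        using r[of z] r[of y] that by (auto simp: abs_le_iff)
      moreover have "d * (z - y) \<le> 0"
        using \<open>d \<le> 0\<close> that by (intro mult_nonpos_nonneg) auto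
      ultimately show ?thesis
        by (simp add: algebra_simps)
    qed
    then show ?thesis
      using \<open>r > 0\<close> by blast
  qed
  then obtain r where r: "\<And>t. t \<in> {u..v} - E \<Longrightarrow> r t > 0"
    "\<And>t y z. t \<in> {u..v} - E \<Longrightarrow> t - r t < y \<Longrightarrow> y \<le> t \<Longrightarrow> t \<le> z \<Longrightarrow> z < t + r t \<Longrightarrow>
        x z - x y \<le> e * (z - y)"
    by metis
  define \<Gamma> where "\<Gamma> t = (if t \<in> E then U else if t \<in> {u..v} then {t - r t<..<t + r t} else UNIV)" for t
  have "gauge \<Gamma>"
    using U r(1) by (intro gaugeI) (auto simp: \<Gamma>_def)
  then obtain p where p: "p tagged_division_of {u..v}" "\<Gamma> fine p"
    using fine_division_exists_real by blast
  note pD = tagged_division_ofD[OF p(1)]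
  define p1 where "p1 = {(t, K) \<in> p. t \<in> E}"
  have p1: "p1 \<subseteq> p" "finite p1"
    using pD(1) by (auto simp: p1_def intro: finite_subset)
  let ?\<Delta> = "\<lambda>f K. f (Sup K) - f (Inf K) :: real"
  have on_E: "(\<Sum>(t, K)\<in>p1. ?\<Delta> x K) \<le> e"
  proof -
    have part: "p1 tagged_partial_division_of {u..v}"
      using p(1) p1(1) tagged_partial_division_subset tagged_division_of_def by blast
    have div: "snd ` p1 division_of \<Union>(snd ` p1)"
      by (rule partial_division_of_tagged_division[OF part])
    have sub: "\<Union>(snd ` p1) \<subseteq> U"
      using p(2) by (force simp: p1_def \<Gamma>_def fine_def)
    have sub': "\<Union>(snd ` p1) \<subseteq> {u..v}"
      using p1(1) pD(3) by force
    have "(\<Sum>(t, K)\<in>p1. ?\<Delta> x K) \<le> (\<Sum>(t, K)\<in>p1. \<bar>?\<Delta> x K\<bar>)"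
      by (intro sum_mono) auto
    also have "\<dots> = (\<Sum>K\<in>snd ` p1. \<bar>?\<Delta> x K\<bar>)"
    proof -
      \<comment> \<open>Two tags can share an interval only if it is degenerate, and then it contributes 0.\<close>
      have "\<bar>?\<Delta> x K\<bar> = 0" if K2: "(t, K) \<in> p" "(t', K) \<in> p" "t \<noteq> t'" for t t' K
      proof -
        obtain l r where K: "K = {l..r}"
          using pD(4)[OF K2(1)] by (auto simp: cbox_interval)
        have "interior K = {}"
          using pD(5)[OF K2(1,2)] K2(3) by simp
        moreover have "l \<le> r"
          using pD(2)[OF K2(1)] K by auto
        ultimately show ?thesis
          using K by (simp add: interior_atLeastAtMost_real)
      qed
      then have "(\<Sum>K\<in>snd ` p1. \<bar>?\<Delta> x K\<bar>) = sum ((\<lambda>K. \<bar>?\<Delta> x K\<bar>) \<circ> snd) p1"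
        using p1 by (intro sum.reindex_nontrivial) (force simp: p1_def)+
      then show ?thesis
        by (simp add: comp_def case_prod_beta)
    qed
    also have "\<dots> < e"
      using division_total_length_in_cover[OF div sub U(1) U3] \<delta>[OF div sub'] by simp
    finally show ?thesis by simp
  qed
  have len: "0 \<le> ?\<Delta> (\<lambda>t. t) K" if "(t, K) \<in> p" for t K
    using pD(2,4)[OF that] by (auto simp: cbox_interval)
  have off_E: "(\<Sum>(t, K)\<in>p - p1. ?\<Delta> x K) \<le> e * (v - u)"
  proof -
    have "(\<Sum>(t, K)\<in>p - p1. ?\<Delta> x K) \<le> (\<Sum>(t, K)\<in>p - p1. e * ?\<Delta> (\<lambda>t. t) K)"
    proof (intro sum_mono, clarify)
      fix t K
      assume tK: "(t, K) \<in> p" "(t, K) \<notin> p1"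
      then have t: "t \<in> {u..v} - E" "t \<in> K"
        using pD(2,3)[OF tK(1)] by (auto simp: p1_def)
      obtain y z where K: "K = {y..z}"
        using pD(4)[OF tK(1)] by (auto simp: cbox_interval)
      have "K \<subseteq> {t - r t<..<t + r t}"
        using fineD[OF p(2) tK(1)] t by (auto simp: \<Gamma>_def)
      then show "?\<Delta> x K \<le> e * ?\<Delta> (\<lambda>t. t) K"
        using r(2)[OF t(1), of y z] t(2) K by (auto simp: subset_iff)
    qed
    also have "\<dots> \<le> (\<Sum>(t, K)\<in>p. e * ?\<Delta> (\<lambda>t. t) K)"
      using pD(1) len \<open>e > 0\<close> by (intro sum_mono2) (auto intro!: mult_nonneg_nonneg)
    also have "\<dots> = e * (v - u)"
      using additive_tagged_division_1[OF \<open>u \<le> v\<close> p(1), of "\<lambda>t. e * t"]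
      by (simp add: right_diff_distrib)
    finally show ?thesis .
  qed
  have "x v - x u = (\<Sum>(t, K)\<in>p. ?\<Delta> x K)"
    using additive_tagged_division_1[OF \<open>u \<le> v\<close> p(1), of x] by simp
  also have "\<dots> = (\<Sum>(t, K)\<in>p - p1. ?\<Delta> x K) + (\<Sum>(t, K)\<in>p1. ?\<Delta> x K)"
    by (rule sum.subset_diff[OF p1(1) pD(1)])
  also have "\<dots> \<le> e * (v - u) + e"
    using on_E off_E by linarith
  also have "\<dots> = e * (v - u + 1)"
    by (simp add: distrib_left)
  also have "\<dots> = e0"
    using \<open>u \<le> v\<close> by (simp add: e_def)
  finally show "x v \<le> x u + e0"
    by simp
qed


lemma abs_cont_on_mean_value:
  assumes "u \<le> v" and ac: "abs_cont_on x u v"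
    and ae: "AE t in lebesgue. u < t \<and> t < v \<longrightarrow> x differentiable at t \<and> \<bar>deriv x t\<bar> \<le> L"
  shows "\<bar>x v - x u\<bar> \<le> L * (v - u)"
proof -
  have lin: "abs_cont_on (\<lambda>t. c * t) u v" for c :: real
    by (rule lipschitz_imp_abs_cont_on[of _ _ _ "\<bar>c\<bar>"])
      (simp add: right_diff_distrib[symmetric] abs_mult)
  have "x v - L * v \<le> x u - L * u"
  proof (rule abs_cont_on_nonincreasing[OF \<open>u \<le> v\<close> abs_cont_on_diff[OF ac lin]])
    show "AE t in lebesgue. u < t \<and> t < v \<longrightarrow>
        (\<exists>d\<le>0. ((\<lambda>t. x t - L * t) has_real_derivative d) (at t))"
      using ae
    proof (eventually_elim, safe)
      fix t
      assume "\<bar>deriv x t\<bar> \<le> L" "x differentiable at t"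
      then show "\<exists>d\<le>0. ((\<lambda>t. x t - L * t) has_real_derivative d) (at t)"
        by (intro exI[of _ "deriv x t - L"] conjI)
          (auto intro!: derivative_eq_intros simp: DERIV_deriv_iff_real_differentiable)
    qed
  qed
  moreover have "- L * v - x v \<le> - L * u - x u"
  proof (rule abs_cont_on_nonincreasing[OF \<open>u \<le> v\<close> abs_cont_on_diff[OF lin ac]])
    show "AE t in lebesgue. u < t \<and> t < v \<longrightarrow>
        (\<exists>d\<le>0. ((\<lambda>t. - L * t - x t) has_real_derivative d) (at t))"
      using ae
    proof (eventually_elim, safe)
      fix t
      assume "\<bar>deriv x t\<bar> \<le> L" "x differentiable at t"
      then show "\<exists>d\<le>0. ((\<lambda>t. - L * t - x t) has_real_derivative d) (at t)"
        by (intro exI[of _ "- L - deriv x t"] conjI)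
          (auto intro!: derivative_eq_intros simp: DERIV_deriv_iff_real_differentiable)
    qed
  qed
  ultimately show ?thesis
    by (auto simp: abs_le_iff algebra_simps)
qed

text \<open>
  After the last time before \<open>t\<close> at which \<open>y \<le> 0\<close>, the function is positive, hence it does not
  increase, so that it cannot have reached a positive value.
\<close>

lemma abs_cont_on_barrier:
  assumes ac: "abs_cont_on y s T" and "y s \<le> 0"
    and ae: "AE t in lebesgue. s < t \<and> t < T \<and> y t > 0 \<longrightarrow> (\<exists>d\<le>0. (y has_real_derivative d) (at t))"
    and t: "s \<le> t" "t \<le> T"
  shows "y t \<le> 0"
proof (rule ccontr)
  assume "\<not> y t \<le> 0"
  define r where "r = Sup {u \<in> {s..t}. y u \<le> 0}"
  have cont: "continuous_on {s..t} y"
    using abs_cont_on_imp_continuous_on[OF ac] t by (rule_tac continuous_on_subset) auto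
  have "closed {u \<in> {s..t}. y u \<le> 0}"
    using continuous_closed_preimage[OF cont closed_atLeastAtMost closed_atMost[of 0]]
    by (simp add: Int_def vimage_def)
  have ne: "{u \<in> {s..t}. y u \<le> 0} \<noteq> {}"
    using t \<open>y s \<le> 0\<close> by auto
  have bdd: "bdd_above {u \<in> {s..t}. y u \<le> 0}"
    by (rule bdd_aboveI[of _ t]) auto
  have "r \<in> {u \<in> {s..t}. y u \<le> 0}"
    unfolding r_def by (rule closed_contains_Sup) fact+
  then have r: "s \<le> r" "r \<le> t" "y r \<le> 0"
    by auto
  have pos: "y u > 0" if "r < u" "u \<le> t" for u
  proof (rule ccontr)
    assume "\<not> y u > 0"
    then have "u \<le> r"
      unfolding r_def using that r by (intro cSup_upper bdd) auto
    then show False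
      using that by simp
  qed
  have "y t \<le> y r"
  proof (rule abs_cont_on_nonincreasing[of r t y])
    show "AE u in lebesgue. r < u \<and> u < t \<longrightarrow> (\<exists>d\<le>0. (y has_real_derivative d) (at u))"
      using ae by eventually_elim (use pos r t in auto)
  qed (use r t abs_cont_on_subinterval[OF ac] in auto)
  then show False
    using r \<open>\<not> y t \<le> 0\<close> by simp
qed

section \<open>The essential supremum norm\<close>

lemma AE_le_ess_norm:
  assumes "f \<in> borel_measurable (lebesgue_on {t0..})" "\<And>t. t \<ge> t0 \<Longrightarrow> \<bar>f t\<bar> \<le> C"
  shows "AE t in lebesgue. t0 \<le> t \<longrightarrow> \<bar>f t\<bar> \<le> ess_norm t0 f"
proof -
  let ?M = "lebesgue_on {t0..}" and ?f = "\<lambda>t. ereal \<bar>f t\<bar>"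
  have "?f \<in> borel_measurable ?M"
    using assms(1) by measurable
  then have "esssup ?M ?f \<le> ereal C"
    by (rule esssup_I) (auto intro!: AE_I2 assms(2))
  moreover have "AE t in ?M. ?f t \<le> esssup ?M ?f"
    by (rule esssup_AE)
  ultimately have "AE t in ?M. \<bar>f t\<bar> \<le> ess_norm t0 f"
    by (elim eventually_mono) (cases "esssup ?M ?f"; simp add: ess_norm_def)
  then show ?thesis
    by (simp add: AE_restrict_space_iff)
qed

lemma ess_norm_nonneg:
  assumes "f \<in> borel_measurable (lebesgue_on {t0..})"
  shows "0 \<le> ess_norm t0 f"
proof -
  let ?M = "lebesgue_on {t0..}" and ?f = "\<lambda>t. ereal \<bar>f t\<bar>"
  have "emeasure ?M (space ?M) \<noteq> 0"
  proof -
    have "emeasure lebesgue {t0..t0 + 1} \<le> emeasure lebesgue {t0..}"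
      by (intro emeasure_mono) auto
    then show ?thesis
      by (auto simp: emeasure_restrict_space)
  qed
  then have "0 = esssup ?M (\<lambda>_. 0 :: ereal)"
    by (simp add: esssup_const)
  also have "\<dots> \<le> esssup ?M ?f"
    by (rule esssup_mono) auto
  finally show ?thesis
    unfolding ess_norm_def by (rule real_of_ereal_pos)
qed

section \<open>Weighted estimates for one solution\<close>

text \<open>
  One solution with fixed initial data of size at most \<open>I\<close>. The numbers \<open>Na\<close>, \<open>Nb k\<close>, \<open>Nab\<close>, \<open>Nbb k\<close> stand for the
  essential norms of \<open>a\<close>, \<open>b k\<close> and of their quotients by \<open>\<Sum>j. b j\<close>; the bounds of the quotients are
  multiplied out. The number \<open>R\<close> bounds every delay, so that \<open>exp (\<gamma> * R)\<close> is the price of moving the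
  weight from a delayed argument to the current time.
\<close>

locale neutral_estimate =
  fixes m :: nat and a g :: "real \<Rightarrow> real" and b h :: "nat \<Rightarrow> real \<Rightarrow> real"
    and s :: real and \<phi> \<psi> x :: "real \<Rightarrow> real"
    and \<alpha> \<gamma> R Na Nab I :: real and Nb Nbb \<tau> :: "nat \<Rightarrow> real"
  assumes rate: "0 < \<gamma>" "\<gamma> < \<alpha>"
    and a_le: "AE t in lebesgue. s \<le> t \<longrightarrow> \<bar>a t\<bar> \<le> Na"
    and ab_le: "AE t in lebesgue. s \<le> t \<longrightarrow> \<bar>a t\<bar> \<le> (\<Sum>j=1..m. b j t) * Nab"
    and b_le: "\<And>k. k \<in> {1..m} \<Longrightarrow> AE t in lebesgue. s \<le> t \<longrightarrow> \<bar>b k t\<bar> \<le> Nb k"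
    and bb_le: "\<And>k. k \<in> {1..m} \<Longrightarrow>
      AE t in lebesgue. s \<le> t \<longrightarrow> \<bar>b k t\<bar> \<le> (\<Sum>j=1..m. b j t) * Nbb k"
    and b_ge: "\<And>t. s \<le> t \<Longrightarrow> \<alpha> \<le> (\<Sum>j=1..m. b j t)"
    and nonneg: "0 \<le> Na" "0 \<le> Nab" "\<And>k. k \<in> {1..m} \<Longrightarrow> 0 \<le> Nb k" "\<And>k. k \<in> {1..m} \<Longrightarrow> 0 \<le> Nbb k"
    and Na_less: "Na * exp (\<gamma> * R) < 1"
    and g_delay: "\<And>t. s \<le> t \<Longrightarrow> t - R \<le> g t \<and> g t \<le> t"
    and h_delay: "\<And>k t. k \<in> {1..m} \<Longrightarrow> s \<le> t \<Longrightarrow> t - \<tau> k \<le> h k t \<and> h k t \<le> t"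
    and \<tau>_le: "\<And>k. k \<in> {1..m} \<Longrightarrow> \<tau> k \<le> R"
    and g_null: "\<And>N. N \<in> null_sets lebesgue \<Longrightarrow> {t \<in> {s..}. g t \<in> N} \<in> null_sets lebesgue"
    and \<phi>_le: "\<And>\<xi>. \<xi> \<le> s \<Longrightarrow> \<bar>\<phi> \<xi>\<bar> \<le> I"
    and \<psi>_le: "\<And>\<xi>. \<xi> < s \<Longrightarrow> \<bar>\<psi> \<xi>\<bar> \<le> I"
    and solution: "neutral_solution m a g b h s \<phi> \<psi> x"
    and deriv_bounded: "locally_ess_bounded_deriv_from s x"
begin

abbreviation decay :: "real \<Rightarrow> real" where
  "decay t \<equiv> exp (- \<gamma> * (t - s))"

abbreviation E :: real where
  "E \<equiv> exp (\<gamma> * R)"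

abbreviation past_deriv :: "real \<Rightarrow> real" where
  "past_deriv t \<equiv> deriv_with_history s \<psi> x (g t)"

abbreviation bsum :: "real \<Rightarrow> real" where
  "bsum t \<equiv> \<Sum>j=1..m. b j t"

lemma I_nonneg: "0 \<le> I"
  using \<phi>_le[of s] by simp

lemma x_history: "t \<le> s \<Longrightarrow> x t = \<phi> t"
  using solution by (simp add: neutral_solution_def)

lemma abs_cont_x: "s \<le> T \<Longrightarrow> abs_cont_on x s T"
  using solution by (simp add: neutral_solution_def locally_abs_cont_from_def)

lemma AE_equation:
  "AE t in lebesgue. s \<le> t \<longrightarrow> x differentiable (at t) \<and>
     deriv x t = a t * past_deriv t - (\<Sum>k=1..m. b k t * x (h k t))"
proof -
  have "AE t in lebesgue_on {s..}. x differentiable (at t) \<and>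
        deriv x t - a t * past_deriv t = - (\<Sum>k=1..m. b k t * x (h k t))"
    using solution by (simp add: neutral_solution_def)
  then show ?thesis
    by (subst (asm) AE_restrict_space_iff) (auto elim!: eventually_mono)
qed

lemma AE_differentiable: "AE t in lebesgue. s \<le> t \<longrightarrow> x differentiable (at t)"
  using AE_equation by eventually_elim simp

lemma AE_deriv_le_delayed:
  "AE t in lebesgue. s \<le> t \<longrightarrow>
     \<bar>deriv x t\<bar> \<le> Na * \<bar>past_deriv t\<bar> + (\<Sum>k=1..m. Nb k * \<bar>x (h k t)\<bar>)"
proof -
  have "AE t in lebesgue. \<forall>k\<in>{1..m}. s \<le> t \<longrightarrow> \<bar>b k t\<bar> \<le> Nb k"
    using b_le by (intro AE_finite_allI) auto
  with AE_equation a_le show ?thesis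
  proof eventually_elim
    case (elim t)
    show ?case
    proof
      assume t: "s \<le> t"
      have "\<bar>deriv x t\<bar> \<le> \<bar>a t * past_deriv t\<bar> + \<bar>\<Sum>k=1..m. b k t * x (h k t)\<bar>"
        using elim t by simp
      also have "\<bar>\<Sum>k=1..m. b k t * x (h k t)\<bar> \<le> (\<Sum>k=1..m. \<bar>b k t * x (h k t)\<bar>)"
        by (rule sum_abs)
      also have "\<dots> \<le> (\<Sum>k=1..m. Nb k * \<bar>x (h k t)\<bar>)"
        using elim t by (intro sum_mono) (simp add: abs_mult mult_right_mono)
      also have "\<bar>a t * past_deriv t\<bar> \<le> Na * \<bar>past_deriv t\<bar>"
        using elim t by (simp add: abs_mult mult_right_mono)
      finally show "\<bar>deriv x t\<bar> \<le> Na * \<bar>past_deriv t\<bar> + (\<Sum>k=1..m. Nb k * \<bar>x (h k t)\<bar>)"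
        by simp
    qed
  qed
qed

text \<open>
  Subtracting \<open>bsum t * x t\<close> on both sides turns the delayed values of the state into differences, which
  are small when the delays are.
\<close>

lemma AE_deriv_perturbed_ode:
  "AE t in lebesgue. s \<le> t \<longrightarrow> \<bar>deriv x t + bsum t * x t\<bar>
     \<le> bsum t * (Nab * \<bar>past_deriv t\<bar> + (\<Sum>k=1..m. Nbb k * \<bar>x t - x (h k t)\<bar>))"
proof -
  have "AE t in lebesgue. \<forall>k\<in>{1..m}. s \<le> t \<longrightarrow> \<bar>b k t\<bar> \<le> bsum t * Nbb k"
    using bb_le by (intro AE_finite_allI) auto
  with AE_equation ab_le show ?thesis
  proof eventually_elim
    case (elim t)
    show ?case
    proof
      assume t: "s \<le> t"
      have "deriv x t + bsum t * x t = a t * past_deriv t + (\<Sum>k=1..m. b k t * (x t - x (h k t)))"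
        using elim t by (simp add: right_diff_distrib sum_subtractf sum_distrib_right)
      then have "\<bar>deriv x t + bsum t * x t\<bar>
          \<le> \<bar>a t * past_deriv t\<bar> + \<bar>\<Sum>k=1..m. b k t * (x t - x (h k t))\<bar>"
        by simp
      also have "\<bar>\<Sum>k=1..m. b k t * (x t - x (h k t))\<bar> \<le> (\<Sum>k=1..m. \<bar>b k t * (x t - x (h k t))\<bar>)"
        by (rule sum_abs)
      also have "\<dots> \<le> (\<Sum>k=1..m. bsum t * Nbb k * \<bar>x t - x (h k t)\<bar>)"
        using elim t by (intro sum_mono) (simp add: abs_mult mult_right_mono)
      also have "\<bar>a t * past_deriv t\<bar> \<le> bsum t * Nab * \<bar>past_deriv t\<bar>"
        using elim t by (simp add: abs_mult mult_right_mono)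
      finally show "\<bar>deriv x t + bsum t * x t\<bar>
          \<le> bsum t * (Nab * \<bar>past_deriv t\<bar> + (\<Sum>k=1..m. Nbb k * \<bar>x t - x (h k t)\<bar>))"
        by (simp add: distrib_left sum_distrib_left mult.assoc)
    qed
  qed
qed

lemma decay_delayed: "decay u \<le> E * decay t" if "t - R \<le> u"
proof -
  have "\<gamma> * (t - R) \<le> \<gamma> * u"
    using that rate by (intro mult_left_mono) auto
  then show ?thesis
    by (simp add: exp_add[symmetric] algebra_simps)
qed

lemma decay_antimono: "decay u \<le> decay t" if "t \<le> u"
  using that rate by simp

text \<open>
  If the delay can reach back before \<open>s\<close>, then \<open>t\<close> is so close to \<open>s\<close> that the weight is still at least \<open>1 / E\<close>;
  so bounds by the initial data can be written in weighted form.
\<close>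

lemma history_delayed: "I \<le> E * I * decay t" if "t - R \<le> s"
proof -
  have "1 \<le> E * decay t"
    using decay_delayed[OF that] by simp
  then have "I * 1 \<le> I * (E * decay t)"
    using I_nonneg by (rule mult_left_mono)
  then show ?thesis by (simp add: mult_ac)
qed

text \<open>
  The bound for the derivative may fail on a null set, but the preimage of this null set under \<open>g\<close> is
  null again, so the bound survives the composition with \<open>g\<close>.
\<close>

lemma AE_past_deriv_le:
  assumes Y: "AE t in lebesgue. s \<le> t \<and> t \<le> T \<longrightarrow> \<bar>deriv x t\<bar> \<le> Y * decay t" and "0 \<le> Y"
  shows "AE t in lebesgue. s \<le> t \<and> t \<le> T \<longrightarrow> \<bar>past_deriv t\<bar> \<le> E * (Y + I) * decay t"
proof -
  obtain N where N: "N \<in> null_sets lebesgue"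
      "\<And>t. t \<notin> N \<Longrightarrow> s \<le> t \<and> t \<le> T \<longrightarrow> \<bar>deriv x t\<bar> \<le> Y * decay t"
    using Y by (auto elim: AE_E3)
  have "AE t in lebesgue. t \<notin> {t \<in> {s..}. g t \<in> N}"
    by (rule AE_not_in[OF g_null[OF N(1)]])
  then show ?thesis
  proof (eventually_elim, intro impI)
    fix t
    assume nin: "t \<notin> {t \<in> {s..}. g t \<in> N}" and t: "s \<le> t \<and> t \<le> T"
    have g: "t - R \<le> g t" "g t \<le> t"
      using g_delay t by auto
    show "\<bar>past_deriv t\<bar> \<le> E * (Y + I) * decay t"
    proof (cases "g t < s")
      case True
      have "\<bar>past_deriv t\<bar> \<le> I"
        using True \<psi>_le by (simp add: deriv_with_history_def)
      also have "\<dots> \<le> E * I * decay t"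
        using True g by (intro history_delayed) auto
      also have "\<dots> \<le> E * (Y + I) * decay t"
        using \<open>0 \<le> Y\<close> by simp
      finally show ?thesis .
    next
      case False
      then have "\<bar>past_deriv t\<bar> \<le> Y * decay (g t)"
        using N(2)[of "g t"] nin t g by (simp add: deriv_with_history_def)
      also have "\<dots> \<le> Y * (E * decay t)"
        using \<open>0 \<le> Y\<close> g by (intro mult_left_mono decay_delayed)
      also have "\<dots> \<le> E * (Y + I) * decay t"
        using I_nonneg by (simp add: algebra_simps)
      finally show ?thesis .
    qed
  qed
qed

lemma past_state_le:
  assumes X: "\<And>u. s \<le> u \<Longrightarrow> u \<le> T \<Longrightarrow> \<bar>x u\<bar> \<le> X * decay u" and "I \<le> X"
    and k: "k \<in> {1..m}" and t: "s \<le> t" "t \<le> T"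
  shows "\<bar>x (h k t)\<bar> \<le> E * X * decay t"
proof -
  have h: "t - R \<le> h k t" "h k t \<le> t"
    using h_delay[OF k t(1)] \<tau>_le[OF k] by auto
  show ?thesis
  proof (cases "h k t < s")
    case True
    have "\<bar>x (h k t)\<bar> \<le> I"
      using True \<phi>_le by (simp add: x_history)
    also have "\<dots> \<le> E * I * decay t"
      using True h by (intro history_delayed) auto
    also have "\<dots> \<le> E * X * decay t"
      using \<open>I \<le> X\<close> by simp
    finally show ?thesis .
  next
    case False
    then have "\<bar>x (h k t)\<bar> \<le> X * decay (h k t)"
      using h t by (intro X) auto
    also have "\<dots> \<le> X * (E * decay t)"
      using \<open>I \<le> X\<close> I_nonneg h by (intro mult_left_mono decay_delayed) auto
    finally show ?thesis by (simp add: mult_ac)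
  qed
qed

text \<open>
  The derivative occurs on both sides of the equation, but on the right with a factor \<open>c\<close>
  that is less than 1 even after the change of weight. So a bound \<open>Y\<close> can be replaced by
  \<open>c * Y + d\<close>, and the iterates tend to \<open>d / (1 - c)\<close> whatever the first bound was.
\<close>

lemma AE_deriv_le:
  assumes X: "\<And>u. s \<le> u \<Longrightarrow> u \<le> T \<Longrightarrow> \<bar>x u\<bar> \<le> X * decay u" and "I \<le> X" "s \<le> T"
  defines "c \<equiv> Na * E" and "d \<equiv> Na * E * I + (\<Sum>k=1..m. Nb k) * E * X"
  shows "AE t in lebesgue. s \<le> t \<and> t \<le> T \<longrightarrow> \<bar>deriv x t\<bar> \<le> d / (1 - c) * decay t"
proof -
  have c: "0 \<le> c" "c < 1"
    using nonneg Na_less by (auto simp: c_def)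
  have "0 \<le> d"
    using nonneg I_nonneg \<open>I \<le> X\<close> by (auto simp: d_def intro!: add_nonneg_nonneg mult_nonneg_nonneg sum_nonneg)
  have step: "AE t in lebesgue. s \<le> t \<and> t \<le> T \<longrightarrow> \<bar>deriv x t\<bar> \<le> (c * Y + d) * decay t"
    if "AE t in lebesgue. s \<le> t \<and> t \<le> T \<longrightarrow> \<bar>deriv x t\<bar> \<le> Y * decay t" "0 \<le> Y" for Y
    using AE_past_deriv_le[OF that] AE_deriv_le_delayed
  proof (eventually_elim, intro impI)
    fix t
    assume t: "s \<le> t \<and> t \<le> T" and p: "s \<le> t \<and> t \<le> T \<longrightarrow> \<bar>past_deriv t\<bar> \<le> E * (Y + I) * decay t"
      and le: "s \<le> t \<longrightarrow> \<bar>deriv x t\<bar> \<le> Na * \<bar>past_deriv t\<bar> + (\<Sum>k=1..m. Nb k * \<bar>x (h k t)\<bar>)"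
    have "\<bar>deriv x t\<bar> \<le> Na * \<bar>past_deriv t\<bar> + (\<Sum>k=1..m. Nb k * \<bar>x (h k t)\<bar>)"
      using le t by simp
    also have "\<dots> \<le> Na * (E * (Y + I) * decay t) + (\<Sum>k=1..m. Nb k * (E * X * decay t))"
      using t p nonneg past_state_le[OF X \<open>I \<le> X\<close>]
      by (intro add_mono mult_left_mono sum_mono) auto
    also have "\<dots> = (c * Y + d) * decay t"
      by (simp add: c_def d_def sum_distrib_right sum_distrib_left algebra_simps)
    finally show "\<bar>deriv x t\<bar> \<le> (c * Y + d) * decay t" .
  qed
  obtain C where "AE t in lebesgue_on {s..T}. \<bar>deriv x t\<bar> \<le> C"
    using deriv_bounded \<open>s \<le> T\<close> by (auto simp: locally_ess_bounded_deriv_from_def)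
  then have C: "AE t in lebesgue. t \<in> {s..T} \<longrightarrow> \<bar>deriv x t\<bar> \<le> C"
    by (subst (asm) AE_restrict_space_iff) auto
  define Y0 where "Y0 = \<bar>C\<bar> * exp (\<gamma> * (T - s))"
  have "0 \<le> Y0"
    by (simp add: Y0_def)
  have Y0: "AE t in lebesgue. s \<le> t \<and> t \<le> T \<longrightarrow> \<bar>deriv x t\<bar> \<le> Y0 * decay t"
    using C
  proof (eventually_elim, intro impI)
    fix t
    assume "t \<in> {s..T} \<longrightarrow> \<bar>deriv x t\<bar> \<le> C" and t: "s \<le> t \<and> t \<le> T"
    then have "\<bar>deriv x t\<bar> \<le> \<bar>C\<bar> * 1"
      by auto
    also have "\<dots> \<le> \<bar>C\<bar> * exp (\<gamma> * (T - t))"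
      using t rate by (intro mult_left_mono) auto
    also have "\<dots> = Y0 * decay t"
      by (simp add: Y0_def exp_add[symmetric] algebra_simps)
    finally show "\<bar>deriv x t\<bar> \<le> Y0 * decay t" .
  qed
  \<comment> \<open>The iterates of \<open>Y \<mapsto> c * Y + d\<close> lie below the fixed point plus a geometric error.\<close>
  have iter: "AE t in lebesgue. s \<le> t \<and> t \<le> T \<longrightarrow> \<bar>deriv x t\<bar> \<le> (d / (1 - c) + Y0 * c ^ n) * decay t" for n
  proof (induction n)
    case 0
    show ?case
      using Y0
    proof (eventually_elim, intro impI)
      fix t
      assume "s \<le> t \<and> t \<le> T \<longrightarrow> \<bar>deriv x t\<bar> \<le> Y0 * decay t" "s \<le> t \<and> t \<le> T"
      moreover have "Y0 * decay t \<le> (d / (1 - c) + Y0 * c ^ 0) * decay t"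
        using c \<open>0 \<le> d\<close> by (intro mult_right_mono) auto
      ultimately show "\<bar>deriv x t\<bar> \<le> (d / (1 - c) + Y0 * c ^ 0) * decay t"
        by (blast intro: order_trans)
    qed
  next
    case (Suc n)
    have "c * (d / (1 - c) + Y0 * c ^ n) + d = d / (1 - c) + Y0 * c ^ Suc n"
      using c by (simp add: field_simps)
    moreover have "0 \<le> d / (1 - c) + Y0 * c ^ n"
      using c \<open>0 \<le> d\<close> \<open>0 \<le> Y0\<close> by simp
    ultimately show ?case
      using step[OF Suc] by simp
  qed
  have "AE t in lebesgue. \<forall>n. s \<le> t \<and> t \<le> T \<longrightarrow> \<bar>deriv x t\<bar> \<le> (d / (1 - c) + Y0 * c ^ n) * decay t"
    by (intro AE_all_countable[THEN iffD2] allI iter)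
  then show ?thesis
  proof (eventually_elim, intro impI)
    fix t
    assume "\<forall>n. s \<le> t \<and> t \<le> T \<longrightarrow> \<bar>deriv x t\<bar> \<le> (d / (1 - c) + Y0 * c ^ n) * decay t"
      and "s \<le> t \<and> t \<le> T"
    moreover have "(\<lambda>n. (d / (1 - c) + Y0 * c ^ n) * decay t) \<longlonglongrightarrow> (d / (1 - c) + Y0 * 0) * decay t"
      using c by (intro tendsto_intros LIMSEQ_power_zero) auto
    ultimately show "\<bar>deriv x t\<bar> \<le> d / (1 - c) * decay t"
      by (intro LIMSEQ_le_const) auto
  qed
qed

lemma increment_le:
  assumes Y: "AE t in lebesgue. s \<le> t \<and> t \<le> T \<longrightarrow> \<bar>deriv x t\<bar> \<le> Y * decay t" and "0 \<le> Y"
    and "s \<le> p" "p \<le> q" "q \<le> T"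
  shows "\<bar>x q - x p\<bar> \<le> Y * decay p * (q - p)"
proof (rule abs_cont_on_mean_value)
  show "abs_cont_on x p q"
    using abs_cont_on_subinterval[OF abs_cont_x[of q]] assms by auto
  show "AE t in lebesgue. p < t \<and> t < q \<longrightarrow> x differentiable (at t) \<and> \<bar>deriv x t\<bar> \<le> Y * decay p"
    using Y AE_differentiable
  proof (eventually_elim, intro impI)
    fix t
    assume "s \<le> t \<and> t \<le> T \<longrightarrow> \<bar>deriv x t\<bar> \<le> Y * decay t" "s \<le> t \<longrightarrow> x differentiable (at t)"
      and t: "p < t \<and> t < q"
    moreover have "Y * decay t \<le> Y * decay p"
      using t \<open>0 \<le> Y\<close> by (intro mult_left_mono decay_antimono) auto
    ultimately show "x differentiable (at t) \<and> \<bar>deriv x t\<bar> \<le> Y * decay p"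
      using assms by auto
  qed
qed fact

text \<open>
  When the delayed argument lies before \<open>s\<close>, the path to it is split at \<open>s\<close>: the increment up to \<open>s\<close> is
  controlled by the derivative, and the rest is a difference of two values of the initial function.
\<close>

lemma delay_difference_le:
  assumes Y: "AE t in lebesgue. s \<le> t \<and> t \<le> T \<longrightarrow> \<bar>deriv x t\<bar> \<le> Y * decay t" and "0 \<le> Y"
    and k: "k \<in> {1..m}" and t: "s \<le> t" "t \<le> T"
  shows "\<bar>x t - x (h k t)\<bar> \<le> E * (\<tau> k * Y + 2 * I) * decay t"
proof -
  have h: "t - \<tau> k \<le> h k t" "t - R \<le> h k t" "h k t \<le> t"
    using h_delay[OF k t(1)] \<tau>_le[OF k] by auto
  have inc: "\<bar>x t - x p\<bar> \<le> E * \<tau> k * Y * decay t" if "s \<le> p" "h k t \<le> p" "p \<le> t" for p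
  proof -
    have "\<bar>x t - x p\<bar> \<le> Y * decay p * (t - p)"
      using that t by (intro increment_le[OF Y \<open>0 \<le> Y\<close>]) auto
    also have "\<dots> \<le> Y * (E * decay t) * \<tau> k"
      using that h \<open>0 \<le> Y\<close> by (intro mult_mono mult_left_mono decay_delayed) auto
    finally show ?thesis by (simp add: mult_ac)
  qed
  show ?thesis
  proof (cases "h k t < s")
    case True
    have "\<bar>x t - x (h k t)\<bar> \<le> \<bar>x t - x s\<bar> + \<bar>\<phi> s\<bar> + \<bar>\<phi> (h k t)\<bar>"
      using True by (simp add: x_history)
    also have "\<dots> \<le> E * \<tau> k * Y * decay t + E * I * decay t + E * I * decay t"
    proof -
      have "\<bar>x t - x s\<bar> \<le> E * \<tau> k * Y * decay t"
        using True t by (intro inc) auto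
      moreover have "I \<le> E * I * decay t"
        using True h by (intro history_delayed) auto
      moreover have "\<bar>\<phi> s\<bar> \<le> I" "\<bar>\<phi> (h k t)\<bar> \<le> I"
        using True by (auto intro!: \<phi>_le)
      ultimately show ?thesis
        by linarith
    qed
    finally show ?thesis by (simp add: algebra_simps)
  next
    case False
    have "\<bar>x t - x (h k t)\<bar> \<le> E * \<tau> k * Y * decay t"
      using inc[of "h k t"] False h by simp
    also have "\<dots> \<le> E * \<tau> k * Y * decay t + E * (2 * I) * decay t"
      using I_nonneg by simp
    finally show ?thesis by (simp add: algebra_simps)
  qed
qed

text \<open>
  In \<open>x' + bsum * x = r\<close> the perturbation satisfies \<open>\<bar>r\<bar> \<le> bsum * P * decay\<close>. Whenever \<open>x\<close> lies above the
  barrier \<open>N * decay\<close>, the damping term dominates both the perturbation and the slope of the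
  barrier, provided that \<open>bsum * P + \<gamma> * N \<le> bsum * N\<close>. By \<open>bsum \<ge> \<alpha>\<close> the choice of \<open>N\<close> achieves this. The same
  holds for \<open>- x\<close>.
\<close>

lemma state_le:
  assumes Y: "AE t in lebesgue. s \<le> t \<and> t \<le> T \<longrightarrow> \<bar>deriv x t\<bar> \<le> Y * decay t" and "0 \<le> Y"
    and t: "s \<le> t" "t \<le> T"
  defines "P \<equiv> E * (Nab * (Y + I) + (\<Sum>k=1..m. Nbb k * (\<tau> k * Y + 2 * I)))"
  shows "\<bar>x t\<bar> \<le> (I + \<alpha> / (\<alpha> - \<gamma>) * P) * decay t"
proof -
  define N where "N = I + \<alpha> / (\<alpha> - \<gamma>) * P"
  have \<tau>_nonneg: "0 \<le> \<tau> k" if "k \<in> {1..m}" for k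
    using h_delay[OF that, of s] by simp
  have "0 \<le> P"
    using nonneg \<open>0 \<le> Y\<close> I_nonneg \<tau>_nonneg
    by (auto simp: P_def intro!: add_nonneg_nonneg mult_nonneg_nonneg sum_nonneg)
  have perturbation: "AE t in lebesgue. s \<le> t \<and> t \<le> T \<longrightarrow> \<bar>deriv x t + bsum t * x t\<bar> \<le> bsum t * (P * decay t)"
    using AE_past_deriv_le[OF Y \<open>0 \<le> Y\<close>] AE_deriv_perturbed_ode
  proof (eventually_elim, intro impI)
    fix t
    assume t: "s \<le> t \<and> t \<le> T" and p: "s \<le> t \<and> t \<le> T \<longrightarrow> \<bar>past_deriv t\<bar> \<le> E * (Y + I) * decay t"
      and le: "s \<le> t \<longrightarrow> \<bar>deriv x t + bsum t * x t\<bar>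
         \<le> bsum t * (Nab * \<bar>past_deriv t\<bar> + (\<Sum>k=1..m. Nbb k * \<bar>x t - x (h k t)\<bar>))"
    have "Nab * \<bar>past_deriv t\<bar> + (\<Sum>k=1..m. Nbb k * \<bar>x t - x (h k t)\<bar>)
        \<le> Nab * (E * (Y + I) * decay t) + (\<Sum>k=1..m. Nbb k * (E * (\<tau> k * Y + 2 * I) * decay t))"
      using t p nonneg delay_difference_le[OF Y \<open>0 \<le> Y\<close>]
      by (intro add_mono mult_left_mono sum_mono) auto
    also have "\<dots> = P * decay t"
      by (simp add: P_def sum_distrib_right sum_distrib_left algebra_simps)
    finally have "bsum t * (Nab * \<bar>past_deriv t\<bar> + (\<Sum>k=1..m. Nbb k * \<bar>x t - x (h k t)\<bar>))
        \<le> bsum t * (P * decay t)"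
      using b_ge[of t] t rate by (intro mult_left_mono) auto
    then show "\<bar>deriv x t + bsum t * x t\<bar> \<le> bsum t * (P * decay t)"
      using le t by linarith
  qed
  have P_le: "B * P + \<gamma> * N \<le> B * N" if "\<alpha> \<le> B" for B
  proof -
    have "\<alpha> * \<gamma> \<le> B * \<gamma>"
      using that rate by (intro mult_right_mono) auto
    then have "B \<le> \<alpha> / (\<alpha> - \<gamma>) * (B - \<gamma>)"
      using rate by (simp add: field_simps)
    then have "B * P \<le> \<alpha> / (\<alpha> - \<gamma>) * (B - \<gamma>) * P"
      using \<open>0 \<le> P\<close> by (rule mult_right_mono)
    also have "\<dots> \<le> I * (B - \<gamma>) + \<alpha> / (\<alpha> - \<gamma>) * (B - \<gamma>) * P"
      using I_nonneg that rate by simp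
    also have "\<dots> = N * (B - \<gamma>)"
      by (simp add: N_def distrib_right)
    finally show ?thesis
      by (simp add: algebra_simps)
  qed
  have "s \<le> T"
    using t by simp
  have decay_ac: "abs_cont_on (\<lambda>t. C * decay t) s T" for C
  proof (rule lipschitz_imp_abs_cont_on)
    fix p q :: real
    assume pq: "s \<le> p" "p \<le> q" "q \<le> T"
    have "\<bar>decay q - decay p\<bar> \<le> \<gamma> * (q - p)"
    proof -
      have "1 + - \<gamma> * (q - p) \<le> exp (- \<gamma> * (q - p))"
        by (rule exp_ge_add_one_self)
      then have "decay p * (1 - exp (- \<gamma> * (q - p))) \<le> 1 * (\<gamma> * (q - p))"
        using pq rate by (intro mult_mono) auto
      moreover have "decay p * exp (- \<gamma> * (q - p)) = decay q"
        by (simp add: exp_add[symmetric] algebra_simps)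
      ultimately show ?thesis
        using decay_antimono[OF pq(2)] by (simp add: right_diff_distrib)
    qed
    then show "\<bar>C * decay q - C * decay p\<bar> \<le> \<bar>C\<bar> * \<gamma> * (q - p)"
      by (simp add: right_diff_distrib[symmetric] abs_mult mult_left_mono mult.assoc)
  qed
  have ac: "abs_cont_on (\<lambda>t. \<epsilon> * x t - N * decay t) s T" if "\<epsilon> \<in> {1, -1}" for \<epsilon>
  proof -
    have "(\<lambda>t. - 1 * x t - N * decay t) = (\<lambda>t. - N * decay t - x t)"
      by (simp add: fun_eq_iff)
    then show ?thesis
      using that abs_cont_on_diff[OF abs_cont_x[OF \<open>s \<le> T\<close>] decay_ac[of N]]
        abs_cont_on_diff[OF decay_ac[of "-N"] abs_cont_x[OF \<open>s \<le> T\<close>]] by auto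
  qed
  have one_sided: "\<epsilon> * x t - N * decay t \<le> 0" if \<epsilon>: "\<epsilon> \<in> {1, -1}" for \<epsilon>
  proof (rule abs_cont_on_barrier[where y = "\<lambda>t. \<epsilon> * x t - N * decay t", OF ac[OF \<epsilon>] _ _ t])
    have "\<epsilon> * x s \<le> I"
      using \<phi>_le[of s] \<epsilon> by (auto simp: x_history)
    moreover have "0 \<le> \<alpha> / (\<alpha> - \<gamma>) * P"
      using rate \<open>0 \<le> P\<close> by simp
    ultimately show "\<epsilon> * x s - N * decay s \<le> 0"
      by (simp add: N_def)
    show "AE t in lebesgue. s < t \<and> t < T \<and> 0 < \<epsilon> * x t - N * decay t \<longrightarrow>
        (\<exists>d\<le>0. ((\<lambda>t. \<epsilon> * x t - N * decay t) has_real_derivative d) (at t))"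
      using perturbation AE_differentiable
    proof (eventually_elim, intro impI)
      fix t
      assume p: "s \<le> t \<and> t \<le> T \<longrightarrow> \<bar>deriv x t + bsum t * x t\<bar> \<le> bsum t * (P * decay t)"
        and diff: "s \<le> t \<longrightarrow> x differentiable (at t)"
        and t: "s < t \<and> t < T \<and> 0 < \<epsilon> * x t - N * decay t"
      have x': "(x has_real_derivative deriv x t) (at t)"
        using diff t by (simp add: DERIV_deriv_iff_real_differentiable)
      have "((\<lambda>t. \<epsilon> * x t - N * decay t) has_real_derivative \<epsilon> * deriv x t + \<gamma> * N * decay t) (at t)"
        by (rule derivative_eq_intros x' refl | simp)+
      moreover have "\<epsilon> * deriv x t + \<gamma> * N * decay t \<le> 0"
      proof -
        have "\<epsilon> * (deriv x t + bsum t * x t) \<le> bsum t * (P * decay t)"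
          using p t \<epsilon> by (auto simp: abs_le_iff)
        moreover have "bsum t * (N * decay t) \<le> bsum t * (\<epsilon> * x t)"
          using t b_ge[of t] rate by (intro mult_left_mono) auto
        moreover have "(bsum t * P + \<gamma> * N) * decay t \<le> (bsum t * N) * decay t"
          using t b_ge[of t] by (intro mult_right_mono P_le) auto
        ultimately show ?thesis
          by (simp add: algebra_simps)
      qed
      ultimately show "\<exists>d\<le>0. ((\<lambda>t. \<epsilon> * x t - N * decay t) has_real_derivative d) (at t)"
        by blast
    qed
  qed
  show ?thesis
    using one_sided[of 1] one_sided[of "-1"] by (auto simp: N_def abs_le_iff)
qed

text \<open>
  Let \<open>W\<close> be the maximum of \<open>\<bar>x\<bar> / decay\<close> up to \<open>T\<close>. It is finite by continuity, so the inequality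
  \<open>W \<le> q * W + c * I\<close>, which follows from the bound of the derivative by the state and the bound of the state by
  the derivative, can be solved for \<open>W\<close>. The constants do not depend on \<open>T\<close> or on the initial data.
\<close>

lemma exponential_bound:
  defines "K \<equiv> Nab + (\<Sum>k=1..m. \<tau> k * Nbb k)" and "S \<equiv> \<Sum>k=1..m. Nb k"
  defines "q \<equiv> \<alpha> / (\<alpha> - \<gamma>) * E * K * (S * E / (1 - Na * E))"
    and "c \<equiv> 1 + \<alpha> / (\<alpha> - \<gamma>) * E * (K * ((Na * E + S * E) / (1 - Na * E)) + Nab + 2 * (\<Sum>k=1..m. Nbb k))"
  assumes "q < 1" "s \<le> T"
  shows "\<bar>x T\<bar> \<le> c / (1 - q) * decay T * I"
proof -
  have "continuous_on {s..T} (\<lambda>u. \<bar>x u\<bar> / decay u)"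
    using abs_cont_on_imp_continuous_on[OF abs_cont_x[OF \<open>s \<le> T\<close>]] by (intro continuous_intros) auto
  then obtain t where t: "t \<in> {s..T}" "\<And>u. u \<in> {s..T} \<Longrightarrow> \<bar>x u\<bar> / decay u \<le> \<bar>x t\<bar> / decay t"
    using continuous_attains_sup[of "{s..T}" "\<lambda>u. \<bar>x u\<bar> / decay u"] \<open>s \<le> T\<close> by auto
  define W where "W = \<bar>x t\<bar> / decay t"
  have "0 \<le> W"
    by (simp add: W_def)
  have W: "\<bar>x u\<bar> \<le> W * decay u" if "s \<le> u" "u \<le> T" for u
  proof -
    have "\<bar>x u\<bar> / decay u \<le> W"
      unfolding W_def using that by (intro t(2)) auto
    then show ?thesis
      by (simp add: pos_divide_le_eq)
  qed
  \<comment> \<open>\<open>AE_deriv_le\<close> asks for a bound of the state that is at least \<open>I\<close>, hence \<open>W + I\<close> in place of \<open>W\<close>.\<close>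
  define Y where "Y = (Na * E * I + S * E * (W + I)) / (1 - Na * E)"
  have "0 \<le> S"
    using nonneg by (auto simp: S_def intro!: sum_nonneg)
  have "0 \<le> Y"
    using nonneg I_nonneg \<open>0 \<le> W\<close> \<open>0 \<le> S\<close> Na_less by (simp add: Y_def)
  have "AE t in lebesgue. s \<le> t \<and> t \<le> T \<longrightarrow> \<bar>deriv x t\<bar> \<le> Y * decay t"
    unfolding Y_def S_def
  proof (rule AE_deriv_le)
    show "\<bar>x u\<bar> \<le> (W + I) * decay u" if "s \<le> u" "u \<le> T" for u
      using W[OF that] I_nonneg by (simp add: distrib_right add_increasing2)
  qed (use \<open>0 \<le> W\<close> \<open>s \<le> T\<close> in auto)
  then have "\<bar>x t\<bar> \<le> (I + \<alpha> / (\<alpha> - \<gamma>) * (E * (Nab * (Y + I) + (\<Sum>k=1..m. Nbb k * (\<tau> k * Y + 2 * I))))) * decay t"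
    using t(1) by (intro state_le[of T]) (auto simp: \<open>0 \<le> Y\<close>)
  then have "W \<le> I + \<alpha> / (\<alpha> - \<gamma>) * (E * (Nab * (Y + I) + (\<Sum>k=1..m. Nbb k * (\<tau> k * Y + 2 * I))))"
    unfolding W_def by (subst pos_divide_le_eq) auto
  also have "Nab * (Y + I) + (\<Sum>k=1..m. Nbb k * (\<tau> k * Y + 2 * I)) = K * Y + (Nab + 2 * (\<Sum>k=1..m. Nbb k)) * I"
    by (simp add: K_def sum.distrib sum_distrib_left sum_distrib_right algebra_simps)
  also have "Y = S * E / (1 - Na * E) * W + (Na * E + S * E) / (1 - Na * E) * I"
    by (simp add: Y_def add_divide_distrib distrib_left distrib_right)
  also have "I + \<alpha> / (\<alpha> - \<gamma>) * (E * (K * (S * E / (1 - Na * E) * W + (Na * E + S * E) / (1 - Na * E) * I)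
      + (Nab + 2 * (\<Sum>k=1..m. Nbb k)) * I)) = q * W + c * I"
    unfolding q_def c_def by (simp only: distrib_left distrib_right mult_1 mult.assoc add.assoc)
  finally have "W * (1 - q) \<le> c * I"
    by (simp add: algebra_simps)
  then have "W \<le> c * I / (1 - q)"
    using \<open>q < 1\<close> by (simp add: pos_le_divide_eq)
  then have "W * decay T \<le> c * I / (1 - q) * decay T"
    by (rule mult_right_mono) simp
  then show ?thesis
    using W[of T] \<open>s \<le> T\<close> by (simp add: mult_ac)
qed

end

section \<open>Uniform exponential stability\<close>

lemma abs_le_initial_sup:
  assumes "initial_data s \<phi> \<psi>"
  shows "\<xi> \<le> s \<Longrightarrow> \<bar>\<phi> \<xi>\<bar> \<le> initial_sup s \<phi> \<psi>" "\<xi> < s \<Longrightarrow> \<bar>\<psi> \<xi>\<bar> \<le> initial_sup s \<phi> \<psi>"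
proof -
  let ?F = "\<lambda>\<xi>. \<bar>\<phi> \<xi>\<bar> + (if \<xi> < s then \<bar>\<psi> \<xi>\<bar> else 0)"
  obtain C1 where C1: "\<And>\<xi>. \<xi> \<le> s \<Longrightarrow> \<bar>\<phi> \<xi>\<bar> \<le> C1"
    using assms by (auto simp: initial_data_def bounded_iff)
  obtain C2 where C2: "\<And>\<xi>. \<xi> < s \<Longrightarrow> \<bar>\<psi> \<xi>\<bar> \<le> C2"
    using assms by (auto simp: initial_data_def bounded_iff)
  have "?F \<xi> \<le> C1 + \<bar>C2\<bar>" if "\<xi> \<le> s" for \<xi>
    using C1[of \<xi>] C2[of \<xi>] that by auto
  then have "bdd_above (?F ` {..s})"
    by (intro bdd_aboveI2[where M = "C1 + \<bar>C2\<bar>"]) auto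
  then have F: "?F \<xi> \<le> initial_sup s \<phi> \<psi>" if "\<xi> \<le> s" for \<xi>
    unfolding initial_sup_def using that by (intro cSUP_upper) auto
  show "\<bar>\<phi> \<xi>\<bar> \<le> initial_sup s \<phi> \<psi>" if "\<xi> \<le> s"
    using F[OF that] by (auto split: if_splits)
  show "\<bar>\<psi> \<xi>\<bar> \<le> initial_sup s \<phi> \<psi>" if "\<xi> < s"
    using F[of \<xi>] that by auto
qed

text \<open>
  At \<open>\<gamma> = 0\<close> the two last inequalities are the hypotheses \<open>Na < 1\<close> and \<open>S / (1 - Na) * K < 1\<close>, and their
  left-hand sides are continuous in \<open>\<gamma>\<close>.
\<close>

lemma exists_decay_rate:
  fixes \<alpha> R Na K S :: real
  assumes "0 < \<alpha>" "Na < 1" "S / (1 - Na) * K < 1"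
  shows "\<exists>\<gamma>. 0 < \<gamma> \<and> \<gamma> < \<alpha> \<and> Na * exp (\<gamma> * R) < 1 \<and>
    \<alpha> / (\<alpha> - \<gamma>) * exp (\<gamma> * R) * K * (S * exp (\<gamma> * R) / (1 - Na * exp (\<gamma> * R))) < 1"
proof -
  have "((\<lambda>\<gamma>. Na * exp (\<gamma> * R)) \<longlongrightarrow> Na * exp (0 * R)) (at_right 0)"
    by (intro tendsto_intros)
  then have "\<forall>\<^sub>F \<gamma> in at_right 0. Na * exp (\<gamma> * R) < 1"
    using \<open>Na < 1\<close> by (intro order_tendstoD) auto
  moreover have lim: "((\<lambda>\<gamma>. \<alpha> / (\<alpha> - \<gamma>) * exp (\<gamma> * R) * K * (S * exp (\<gamma> * R) / (1 - Na * exp (\<gamma> * R))))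
      \<longlongrightarrow> \<alpha> / (\<alpha> - 0) * exp (0 * R) * K * (S * exp (0 * R) / (1 - Na * exp (0 * R)))) (at_right 0)"
    using assms by (intro tendsto_intros) auto
  have "\<forall>\<^sub>F \<gamma> in at_right 0.
      \<alpha> / (\<alpha> - \<gamma>) * exp (\<gamma> * R) * K * (S * exp (\<gamma> * R) / (1 - Na * exp (\<gamma> * R))) < 1"
    using order_tendstoD(2)[OF lim, of 1] assms by (simp add: mult.commute)
  moreover have "\<forall>\<^sub>F \<gamma> in at_right 0. 0 < \<gamma> \<and> \<gamma> < \<alpha>"
    using eventually_at_right_real[OF \<open>0 < \<alpha>\<close>] by (simp add: greaterThanLessThan_iff)
  ultimately have "\<forall>\<^sub>F \<gamma> in at_right 0. 0 < \<gamma> \<and> \<gamma> < \<alpha> \<and> Na * exp (\<gamma> * R) < 1 \<and>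
      \<alpha> / (\<alpha> - \<gamma>) * exp (\<gamma> * R) * K * (S * exp (\<gamma> * R) / (1 - Na * exp (\<gamma> * R))) < 1"
    by eventually_elim blast
  then show ?thesis
    by (rule eventually_happens'[rotated]) simp
qed

theorem theorem2:
  fixes t0 A0 b0 \<sigma> \<alpha> :: real and m :: nat
    and a g :: "real \<Rightarrow> real" and b h :: "nat \<Rightarrow> real \<Rightarrow> real"
    and B \<tau> :: "nat \<Rightarrow> real"
  assumes "t0 \<ge> 0" and "m \<ge> 1"
    and "a \<in> borel_measurable (lebesgue_on {t0..})"
    and "g \<in> borel_measurable (lebesgue_on {t0..})"
    and "\<And>k. k \<in> {1..m} \<Longrightarrow> b k \<in> borel_measurable (lebesgue_on {t0..})"
    and "\<And>k. k \<in> {1..m} \<Longrightarrow> h k \<in> borel_measurable (lebesgue_on {t0..})"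
    and "A0 < 1" and "\<And>t. t \<ge> t0 \<Longrightarrow> \<bar>a t\<bar> \<le> A0"
    and "\<And>k t. k \<in> {1..m} \<Longrightarrow> t \<ge> t0 \<Longrightarrow> b0 \<le> b k t \<and> b k t \<le> B k"
    and "\<sigma> > 0" and "\<And>k. k \<in> {1..m} \<Longrightarrow> \<tau> k > 0"
    and "\<And>t. t \<ge> t0 \<Longrightarrow> 0 \<le> t - g t \<and> t - g t \<le> \<sigma>"
    and "\<And>k t. k \<in> {1..m} \<Longrightarrow> t \<ge> t0 \<Longrightarrow> 0 \<le> t - h k t \<and> t - h k t \<le> \<tau> k"
    and "\<And>E. E \<in> null_sets lebesgue \<Longrightarrow> {t \<in> {t0..}. g t \<in> E} \<in> null_sets lebesgue"
    and "\<alpha> > 0" and "\<And>t. t \<ge> t0 \<Longrightarrow> (\<Sum>k=1..m. b k t) \<ge> \<alpha>"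
    and "ess_norm t0 a < 1"
    and "((\<Sum>k=1..m. ess_norm t0 (b k)) / (1 - ess_norm t0 a)) *
         (ess_norm t0 (\<lambda>t. a t / (\<Sum>j=1..m. b j t)) +
          (\<Sum>k=1..m. \<tau> k * ess_norm t0 (\<lambda>t. b k t / (\<Sum>j=1..m. b j t)))) < 1"
  shows "uniformly_exponentially_stable t0 m a g b h"
proof -
  note a_meas = assms(3) and b_meas = assms(5) and a_bound = assms(8) and b_bound = assms(9)
    and \<tau>_pos = assms(11) and g_delay = assms(12) and h_delay = assms(13) and g_null = assms(14)
    and \<alpha>_pos = assms(15) and b_ge = assms(16) and small = assms(17,18)
  let ?b = "\<lambda>t. \<Sum>j=1..m. b j t"
  define Na where "Na = ess_norm t0 a"
  define Nb where "Nb k = ess_norm t0 (b k)" for k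
  define Nab where "Nab = ess_norm t0 (\<lambda>t. a t / ?b t)"
  define Nbb where "Nbb k = ess_norm t0 (\<lambda>t. b k t / ?b t)" for k
  \<comment> \<open>A common bound of all delays; the sum avoids a maximum over \<open>k\<close>.\<close>
  define R where "R = \<sigma> + (\<Sum>k=1..m. \<tau> k)"
  define K where "K = Nab + (\<Sum>k=1..m. \<tau> k * Nbb k)"
  define S where "S = (\<Sum>k=1..m. Nb k)"
  have bsum_meas: "?b \<in> borel_measurable (lebesgue_on {t0..})"
    using b_meas by (intro borel_measurable_sum) auto
  have b_abs: "\<bar>b k t\<bar> \<le> \<bar>b0\<bar> + \<bar>B k\<bar>" if "k \<in> {1..m}" "t0 \<le> t" for k t
    using b_bound[OF that] by linarith
  have quotient_le: "\<bar>c / ?b t\<bar> \<le> \<bar>C\<bar> / \<alpha>" if "\<bar>c\<bar> \<le> C" "t0 \<le> t" for c C t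
    using that b_ge[OF that(2)] \<alpha>_pos unfolding abs_divide by (intro frac_le) auto
  have quotient_norm: "AE t in lebesgue. t0 \<le> t \<longrightarrow> \<bar>f t\<bar> \<le> ?b t * ess_norm t0 (\<lambda>t. f t / ?b t)"
    if f: "f \<in> borel_measurable (lebesgue_on {t0..})" "\<And>t. t0 \<le> t \<Longrightarrow> \<bar>f t\<bar> \<le> C" for f C
  proof -
    have "AE t in lebesgue. t0 \<le> t \<longrightarrow> \<bar>f t / ?b t\<bar> \<le> ess_norm t0 (\<lambda>t. f t / ?b t)"
      using f bsum_meas by (intro AE_le_ess_norm[where C = "\<bar>C\<bar> / \<alpha>"] borel_measurable_divide quotient_le) auto
    then show ?thesis
    proof (eventually_elim, intro impI)
      fix t
      assume "t0 \<le> t \<longrightarrow> \<bar>f t / ?b t\<bar> \<le> ess_norm t0 (\<lambda>t. f t / ?b t)" "t0 \<le> t"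
      moreover have "0 < ?b t"
        using b_ge[OF \<open>t0 \<le> t\<close>] \<alpha>_pos by linarith
      ultimately show "\<bar>f t\<bar> \<le> ?b t * ess_norm t0 (\<lambda>t. f t / ?b t)"
        by (simp add: abs_divide pos_divide_le_eq mult.commute)
    qed
  qed
  have nonneg: "0 \<le> Na" "0 \<le> Nab" "\<And>k. k \<in> {1..m} \<Longrightarrow> 0 \<le> Nb k" "\<And>k. k \<in> {1..m} \<Longrightarrow> 0 \<le> Nbb k"
    unfolding Na_def Nab_def Nb_def Nbb_def using a_meas b_meas bsum_meas
    by (auto intro!: ess_norm_nonneg borel_measurable_divide)
  have \<tau>_le: "\<tau> k \<le> R" if "k \<in> {1..m}" for k
    using member_le_sum[of k "{1..m}" \<tau>] that \<tau>_pos \<open>\<sigma> > 0\<close> by (force simp: R_def less_imp_le)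
  have "\<sigma> \<le> R"
    using \<tau>_pos by (auto simp: R_def less_imp_le intro!: sum_nonneg)
  obtain \<gamma> where \<gamma>: "0 < \<gamma>" "\<gamma> < \<alpha>" "Na * exp (\<gamma> * R) < 1"
    and q: "\<alpha> / (\<alpha> - \<gamma>) * exp (\<gamma> * R) * K * (S * exp (\<gamma> * R) / (1 - Na * exp (\<gamma> * R))) < 1"
    using exists_decay_rate[of \<alpha> Na S K R] \<alpha>_pos small
    by (auto simp: Na_def S_def K_def Nb_def Nab_def Nbb_def)
  define c where "c = 1 + \<alpha> / (\<alpha> - \<gamma>) * exp (\<gamma> * R) *
    (K * ((Na * exp (\<gamma> * R) + S * exp (\<gamma> * R)) / (1 - Na * exp (\<gamma> * R))) + Nab + 2 * (\<Sum>k=1..m. Nbb k))"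
  define M where "M = c / (1 - \<alpha> / (\<alpha> - \<gamma>) * exp (\<gamma> * R) * K * (S * exp (\<gamma> * R) / (1 - Na * exp (\<gamma> * R))))"
  have "0 \<le> K" "0 \<le> S" "0 \<le> (\<Sum>k=1..m. Nbb k)"
    using nonneg \<tau>_pos by (auto simp: K_def S_def less_imp_le intro!: add_nonneg_nonneg sum_nonneg mult_nonneg_nonneg)
  then have "0 < c"
    unfolding c_def using nonneg \<gamma>
    by (intro add_pos_nonneg mult_nonneg_nonneg add_nonneg_nonneg divide_nonneg_nonneg) auto
  then have "0 < M"
    using q by (simp add: M_def)
  moreover have "\<bar>x t\<bar> \<le> M * exp (- \<gamma> * (t - s)) * initial_sup s \<phi> \<psi>"
    if s: "t0 \<le> s" and data: "initial_data s \<phi> \<psi>" and sol: "neutral_solution m a g b h s \<phi> \<psi> x"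
      and bounded: "locally_ess_bounded_deriv_from s x" and t: "s \<le> t" for s \<phi> \<psi> x t
  proof -
    have from_s: "AE t in lebesgue. s \<le> t \<longrightarrow> P t" if "AE t in lebesgue. t0 \<le> t \<longrightarrow> P t" for P
      using that by eventually_elim (use s in auto)
    interpret neutral_estimate m a g b h s \<phi> \<psi> x \<alpha> \<gamma> R Na Nab "initial_sup s \<phi> \<psi>" Nb Nbb \<tau>
    proof
      show "AE t in lebesgue. s \<le> t \<longrightarrow> \<bar>a t\<bar> \<le> Na"
        unfolding Na_def using a_meas a_bound by (intro from_s AE_le_ess_norm)
      show "AE t in lebesgue. s \<le> t \<longrightarrow> \<bar>a t\<bar> \<le> ?b t * Nab"
        unfolding Nab_def using a_meas a_bound by (intro from_s quotient_norm)
      show "AE t in lebesgue. s \<le> t \<longrightarrow> \<bar>b k t\<bar> \<le> Nb k" if "k \<in> {1..m}" for k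
        unfolding Nb_def using b_meas[OF that] b_abs[OF that] by (intro from_s AE_le_ess_norm)
      show "AE t in lebesgue. s \<le> t \<longrightarrow> \<bar>b k t\<bar> \<le> ?b t * Nbb k" if "k \<in> {1..m}" for k
        unfolding Nbb_def using b_meas[OF that] b_abs[OF that] by (intro from_s quotient_norm)
      show "{t \<in> {s..}. g t \<in> N} \<in> null_sets lebesgue" if "N \<in> null_sets lebesgue" for N
        using g_null[OF that] s by (auto simp: negligible_iff_null_sets[symmetric] elim!: negligible_subset)
      show "t - R \<le> g t \<and> g t \<le> t" if "s \<le> t" for t
        using g_delay[of t] that s \<open>\<sigma> \<le> R\<close> by auto
      show "t - \<tau> k \<le> h k t \<and> h k t \<le> t" if "k \<in> {1..m}" "s \<le> t" for k t
        using h_delay[of k t] that s by auto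
      show "\<alpha> \<le> ?b t" if "s \<le> t" for t
        using b_ge that s by auto
    qed (use \<gamma> nonneg \<tau>_le data sol bounded abs_le_initial_sup in auto)
    show ?thesis
      using exponential_bound q t unfolding M_def c_def K_def S_def by simp
  qed
  ultimately show ?thesis
    unfolding uniformly_exponentially_stable_def using \<gamma>(1) by blast
qed

end
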